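(* Let $w\in\{a,b\}^+$ be a segment of the Prouhet-Thue-Morse sequence $\mathbf{t}$ containing as a factor at least one of the segments $aba$ and $bab$, along with all other segments of $\mathbf{t}$ of length $3$ (namely $aab$, $abb$, $baa$, $bba$). Then $w$ is typical.
   Context: Let $\{a,b\}^+$ be the free semigroup (nonempty finite words) on $\{a,b\}$. Let $\mu$ be the endomorphism of $\{a,b\}^+$ with $\mu(a)=ab$, $\mu(b)=ba$, and let $\xi$ be the endomorphism with $\xi(a)=b$, $\xi(b)=a$. The Prouhet-Thue-Morse sequence $\mathbf{t}$ is the infinite word over $\{a,b\}$ whose prefix of length $2^n$ is $\mu^n(a)$ for every $n\ge 0$. A finite segment of an infinite word $a_1a_2\cdots$ is a word of the form $a_ka_{k+1}\cdots a_\ell$ with $k\le\ell$. A word $u$ is a factor of a word $v$ if $v=xuy$ for some (possibly empty) words $x,y$. A finite segment $w$ of $\mathbf{t}$ is atypical if there is an endomorphism $\varphi$ of the semigroup $\{a,b\}^+$ such that $\varphi(w)$ is also a segment of $\mathbf{t}$ and $\varphi$ is not of one of the forms $\mu^n$ or $\xi\circ\mu^n$ with $n\ge 0$ ($\mu^0$ is the identity). Finite segments of $\mathbf{t}$ that are not atypical are said to be typical. *)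

theory Defs
  imports "HOL-Library.Sublist"
begin

text \<open>Words over the two-letter alphabet are lists. The free semigroup consists of the nonempty
  ones, so maps on it are list functions considered only on nonempty arguments.\<close>

datatype letter = La | Lb

definition words :: "letter list set" where
  "words = {w. w \<noteq> []}"

definition endomorphism :: "(letter list \<Rightarrow> letter list) \<Rightarrow> bool" where
  "endomorphism \<phi> \<longleftrightarrow>
     (\<forall>u\<in>words. \<phi> u \<in> words) \<and> (\<forall>u\<in>words. \<forall>v\<in>words. \<phi> (u @ v) = \<phi> u @ \<phi> v)"

fun \<mu>_letter :: "letter \<Rightarrow> letter list" where
  "\<mu>_letter La = [La, Lb]"
| "\<mu>_letter Lb = [Lb, La]"

fun \<xi>_letter :: "letter \<Rightarrow> letter list" where
  "\<xi>_letter La = [Lb]"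
| "\<xi>_letter Lb = [La]"

definition \<mu> :: "letter list \<Rightarrow> letter list" where
  "\<mu> w = concat (map \<mu>_letter w)"

definition \<xi> :: "letter list \<Rightarrow> letter list" where
  "\<xi> w = concat (map \<xi>_letter w)"

lemma \<mu>_simps [simp]:
  "\<mu> [] = []" "\<mu> (x # w) = \<mu>_letter x @ \<mu> w" "\<mu> (u @ v) = \<mu> u @ \<mu> v"
  by (simp_all add: \<mu>_def)

lemma \<xi>_simps [simp]:
  "\<xi> [] = []" "\<xi> (x # w) = \<xi>_letter x @ \<xi> w" "\<xi> (u @ v) = \<xi> u @ \<xi> v"
  by (simp_all add: \<xi>_def)

lemma length_\<mu> [simp]: "length (\<mu> w) = 2 * length w"
proof (induction w)
  case (Cons x w)
  then show ?case by (cases x) simp_all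
qed simp

lemma length_\<xi> [simp]: "length (\<xi> w) = length w"
proof (induction w)
  case (Cons x w)
  then show ?case by (cases x) simp_all
qed simp

lemma \<mu>_eq_Nil_iff [simp]: "\<mu> w = [] \<longleftrightarrow> w = []"
  using length_\<mu>[of w] by (metis mult_eq_0_iff zero_neq_numeral length_0_conv)

lemma endomorphism_\<mu>: "endomorphism \<mu>"
  by (simp add: endomorphism_def words_def)

lemma \<xi>_eq_Nil_iff [simp]: "\<xi> w = [] \<longleftrightarrow> w = []"
  using length_\<xi>[of w] by (metis length_0_conv)

lemma endomorphism_\<xi>: "endomorphism \<xi>"
  by (simp add: endomorphism_def words_def)

text \<open>The Prouhet-Thue-Morse sequence, indexed from 0: entry \<open>i\<close> is read off the prefix
  \<open>\<mu>\<^sup>i(a)\<close>, which has length \<open>2\<^sup>i > i\<close>. Lemmas \<open>ptm_prefix\<close> and \<open>ptm_unique\<close>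
  show that this is the infinite word determined by its prefixes \<open>\<mu>\<^sup>n(a)\<close>.\<close>

definition ptm :: "nat \<Rightarrow> letter" where
  "ptm i = (\<mu> ^^ i) [La] ! i"

lemma length_\<mu>_pow [simp]: "length ((\<mu> ^^ n) w) = 2 ^ n * length w"
  by (induction n) simp_all

lemma \<mu>_pow_append: "(\<mu> ^^ n) (u @ v) = (\<mu> ^^ n) u @ (\<mu> ^^ n) v"
  by (induction n) simp_all

lemma \<mu>_pow_mono:
  assumes "m \<le> n"
  shows "prefix ((\<mu> ^^ m) [La]) ((\<mu> ^^ n) [La])"
  using assms
proof (induction rule: dec_induct)
  case (step n)
  have "(\<mu> ^^ Suc n) [La] = (\<mu> ^^ n) ([La] @ [Lb])"
    by (simp add: funpow_Suc_right del: funpow.simps)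
  then have "prefix ((\<mu> ^^ n) [La]) ((\<mu> ^^ Suc n) [La])"
    by (simp add: \<mu>_pow_append del: append_Cons funpow.simps)
  with step.IH show ?case
    by (rule prefix_order.trans)
qed simp

lemma \<mu>_pow_nth:
  assumes "i < 2 ^ m" "i < 2 ^ n"
  shows "(\<mu> ^^ m) [La] ! i = (\<mu> ^^ n) [La] ! i"
proof -
  have *: "(\<mu> ^^ k) [La] ! i = (\<mu> ^^ l) [La] ! i" if "k \<le> l" "i < 2 ^ k" for k l
    using \<mu>_pow_mono[OF that(1)] that(2) by (auto simp: prefix_def nth_append)
  show ?thesis
    using *[OF _ assms(1), of n] *[OF _ assms(2), of m] by (metis nle_le)
qed

lemma ptm_prefix: "map ptm [0..<2 ^ n] = (\<mu> ^^ n) [La]"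
proof (rule nth_equalityI)
  fix i assume "i < length (map ptm [0..<2 ^ n])"
  then show "map ptm [0..<2 ^ n] ! i = (\<mu> ^^ n) [La] ! i"
    using \<mu>_pow_nth[of i i n] by (simp add: ptm_def)
qed simp

lemma ptm_unique:
  assumes "\<And>n. map t [0..<2 ^ n] = (\<mu> ^^ n) [La]"
  shows "t = ptm"
proof
  fix i :: nat
  have "map t [0..<2 ^ i] ! i = map ptm [0..<2 ^ i] ! i"
    by (simp only: assms ptm_prefix)
  then show "t i = ptm i"
    by simp
qed

definition segment :: "(nat \<Rightarrow> letter) \<Rightarrow> letter list \<Rightarrow> bool" where
  "segment s w \<longleftrightarrow> (\<exists>k l. k \<le> l \<and> w = map s [k..<Suc l])"

text \<open>Equality of endomorphisms is agreement on \<open>words\<close>, since the value at \<open>[]\<close>, which is not in the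
  free semigroup, is irrelevant.\<close>

definition atypical :: "letter list \<Rightarrow> bool" where
  "atypical w \<longleftrightarrow> segment ptm w \<and>
     (\<exists>\<phi>. endomorphism \<phi> \<and> segment ptm (\<phi> w) \<and>
        \<not> (\<exists>n. (\<forall>u\<in>words. \<phi> u = (\<mu> ^^ n) u) \<or> (\<forall>u\<in>words. \<phi> u = (\<xi> \<circ> \<mu> ^^ n) u)))"

definition typical :: "letter list \<Rightarrow> bool" where
  "typical w \<longleftrightarrow> segment ptm w \<and> \<not> atypical w"

end

theory Submission
  imports Defs
begin

text \<open>Put \<open>A = \<phi>(a)\<close> and \<open>B = \<phi>(b)\<close>, so that \<open>AAB\<close>, \<open>ABB\<close>, \<open>BAA\<close>, \<open>BBA\<close> and one of
  \<open>ABA\<close>, \<open>BAB\<close> occur in the sequence. Because \<open>t\<close> is a fixed point of \<open>\<mu>\<close>, a square of a letter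
  occurs at odd positions only; hence a word containing one occurs at positions of a single parity.
  This forces \<open>|A|\<close> and \<open>|B|\<close> to be even, except when \<open>A\<close> and \<open>B\<close> are the two letters. When both are
  even, the occurrences are all aligned with the blocks of \<open>\<mu>\<close>, so that \<open>A = \<mu>(A')\<close>, \<open>B = \<mu>(B')\<close> and
  one descends to the shorter pair, or all are shifted by one. In the latter case \<open>A\<close> and \<open>B\<close> end in
  the same letter, and moving it to the front of both gives an aligned pair of words with equal first
  letters; but the descent shows that an aligned pair has distinct first letters.\<close>

section \<open>Occurrences in the Prouhet-Thue-Morse sequence\<close>

lemma \<mu>_nth:
  assumes "i < length w"
  shows "[\<mu> w ! (2 * i), \<mu> w ! Suc (2 * i)] = \<mu>_letter (w ! i)"
  using assms
proof (induction w arbitrary: i)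
  case (Cons x w)
  then show ?case
    by (cases i; cases x) auto
qed simp

text \<open>The sequence is a fixed point of \<open>\<mu>\<close>: its prefix of length
  \<open>2 ^ Suc i\<close> is the image of the one of length \<open>2 ^ i\<close>, which already
  covers position \<open>i\<close>.\<close>

lemma \<mu>_letter_ptm: "\<mu>_letter (ptm i) = [ptm (2 * i), ptm (Suc (2 * i))]"
proof -
  have p: "map ptm [0..<2 ^ Suc i] = \<mu> (map ptm [0..<2 ^ i])"
    unfolding ptm_prefix by simp
  have i: "i < 2 ^ i" by simp
  have "\<mu> (map ptm [0..<2 ^ i]) ! j = ptm j" if "j < 2 ^ Suc i" for j
    unfolding p[symmetric] using that by simp
  moreover have "2 * i < 2 ^ Suc i" "Suc (2 * i) < 2 ^ Suc i"
    using i by (simp_all, linarith)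
  ultimately show ?thesis
    using \<mu>_nth[of i "map ptm [0..<2 ^ i]"] i by (simp del: \<mu>_letter.simps)
qed

lemma ptm_double: "ptm (2 * i) = ptm i" "ptm (Suc (2 * i)) \<noteq> ptm i"
  using \<mu>_letter_ptm[of i] by (cases "ptm i"; auto)+

lemma letter_eqI: "x = y" if "x \<noteq> z" "y \<noteq> z" for x y z :: letter
  using that by (cases x; cases y; cases z) auto

lemma ptm_square: "odd p" if "ptm p = ptm (Suc p)"
  using that ptm_double by (metis evenE)

lemma ptm_no_cube: "\<not> (ptm p = ptm (Suc p) \<and> ptm (Suc p) = ptm (Suc (Suc p)))"
  using ptm_square[of p] ptm_square[of "Suc p"] by auto

text \<open>Positions of one parity read the sequence itself or its complement, so three equal
  letters at distance 2 would give a cube of a letter. In particular \<open>ababa\<close> and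
  \<open>babab\<close> do not occur.\<close>

lemma ptm_no_spaced_cube: "\<not> (ptm p = ptm (p + 2) \<and> ptm (p + 2) = ptm (p + 4))"
proof
  assume *: "ptm p = ptm (p + 2) \<and> ptm (p + 2) = ptm (p + 4)"
  show False
  proof (cases "even p")
    case True
    then obtain i where "p = 2 * i" by (elim evenE)
    then show False
      using * ptm_no_cube[of i] ptm_double(1)[of i] ptm_double(1)[of "Suc i"]
        ptm_double(1)[of "Suc (Suc i)"] by (simp add: eval_nat_numeral)
  next
    case False
    then obtain i where "p = Suc (2 * i)" by (auto elim: oddE)
    then have "ptm i \<noteq> ptm p" "ptm (Suc i) \<noteq> ptm p" "ptm (Suc (Suc i)) \<noteq> ptm p"
      using * ptm_double(2)[of i] ptm_double(2)[of "Suc i"] ptm_double(2)[of "Suc (Suc i)"]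
      by (simp_all add: eval_nat_numeral)
    then show False
      using ptm_no_cube letter_eqI by blast
  qed
qed

primrec occ :: "nat \<Rightarrow> letter list \<Rightarrow> bool" where
  "occ p [] \<longleftrightarrow> True"
| "occ p (x # w) \<longleftrightarrow> ptm p = x \<and> occ (Suc p) w"

lemma occ_append [simp]: "occ p (u @ v) \<longleftrightarrow> occ p u \<and> occ (p + length u) v"
  by (induction u arbitrary: p) auto

lemma occ_map_ptm: "occ k (map ptm [k..<l])"
proof (induction "l - k" arbitrary: k)
  case (Suc n)
  then show ?case
    by (simp add: upt_conv_Cons)
qed simp

lemma occ_if_sublist_segment:
  assumes "segment ptm w" "sublist u w"
  shows "\<exists>p. occ p u"
proof -
  obtain k l where "w = map ptm [k..<l]"
    using assms(1) unfolding segment_def by blast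
  then have "occ k w" by (simp add: occ_map_ptm)
  then show ?thesis
    using assms(2) by (auto simp: sublist_def)
qed

lemma occ_hd: "ptm p = hd w" if "occ p w" "w \<noteq> []"
  using that by (cases w) auto

text \<open>The square of a letter formed where \<open>u\<close> meets \<open>v\<close> starts one
  position before \<open>v\<close>, and that position is odd.\<close>

lemma occ_junction:
  assumes "occ p (u @ v)" "u \<noteq> []" "v \<noteq> []" "last u = hd v"
  shows "even (p + length u)"
proof -
  obtain u' c where u: "u = u' @ [c]"
    using assms(2) by (cases u rule: rev_cases) auto
  have "ptm (p + length u') = ptm (Suc (p + length u'))"
    using assms u occ_hd[of "p + length u" v] by simp
  then have "odd (p + length u')"
    by (rule ptm_square)
  then show ?thesis
    by (simp add: u del: even_add)
qed

text \<open>Desubstitution: a word cut along the block boundaries is decoded two letters at a time,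
  the block at \<open>2 * p\<close> being the image of \<open>ptm p\<close>.\<close>

lemma occ_even_\<mu>:
  assumes "occ (2 * p) w" "even (length w)"
  shows "\<exists>v. w = \<mu> v \<and> occ p v"
  using assms
proof (induction w arbitrary: p rule: length_induct)
  case (1 w)
  show ?case
  proof (cases w)
    case Nil
    then show ?thesis by (intro exI[of _ "[]"]) simp
  next
    case (Cons x w')
    then obtain y u where w: "w = x # y # u"
      using 1(3) by (cases w') auto
    have "occ (2 * Suc p) u" "even (length u)" "length u < length w"
      using 1(2,3) w by simp_all
    then obtain v where v: "u = \<mu> v" "occ (Suc p) v"
      using 1(1) by blast
    have "w = \<mu> (ptm p # v)" "occ p (ptm p # v)"
      using 1(2) v w \<mu>_letter_ptm[of p] by simp_all
    then show ?thesis by blast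
  qed
qed

lemma inj_\<mu>: "\<mu> u = \<mu> v \<longleftrightarrow> u = v"
proof (induction u arbitrary: v)
  case Nil
  then show ?case by (metis \<mu>_eq_Nil_iff)
next
  case (Cons x u)
  show ?case
  proof (cases v)
    case Nil
    then show ?thesis by (cases x) auto
  next
    case (Cons y v')
    then show ?thesis using Cons.IH by (cases x; cases y) auto
  qed
qed

lemma occ_\<mu>: "occ p v" if "occ (2 * p) (\<mu> v)"
  using occ_even_\<mu>[OF that] by (auto simp: inj_\<mu>)

section \<open>Words containing the square of a letter\<close>

definition has_square :: "letter list \<Rightarrow> bool" where
  "has_square w \<longleftrightarrow> (\<exists>x. sublist [x, x] w)"

lemma has_square_Cons:
  "has_square (x # w) \<longleftrightarrow> (w \<noteq> [] \<and> hd w = x) \<or> has_square w"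
  unfolding has_square_def by (cases w) (auto simp: sublist_Cons_right)

lemma not_has_square_Nil [simp]: "\<not> has_square []"
  by (simp add: has_square_def)

lemma has_square_append:
  "has_square (u @ v) \<longleftrightarrow>
     has_square u \<or> has_square v \<or> (u \<noteq> [] \<and> v \<noteq> [] \<and> last u = hd v)"
  by (induction u) (auto simp: has_square_Cons)

text \<open>The square sits at a fixed offset in \<open>w\<close>, and both of its occurrences start
  at odd positions.\<close>

lemma occ_parity:
  assumes "has_square w" "occ p w" "occ q w"
  shows "even p \<longleftrightarrow> even q"
proof -
  obtain u x v where "w = u @ [x, x] @ v"
    using assms(1) by (auto simp: has_square_def sublist_def)
  then show ?thesis
    using assms(2,3) ptm_square[of "p + length u"] ptm_square[of "q + length u"] by simp
qed

text \<open>Without such a square the letters alternate, and five alternating letters form a spaced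
  cube.\<close>

lemma has_square_if_long:
  assumes "occ p w" "length w \<ge> 5"
  shows "has_square w"
proof -
  obtain a b c d e v where w: "w = a # b # c # d # e # v"
    using assms(2) by (auto simp: eval_nat_numeral Suc_le_length_iff)
  have "\<not> (a = c \<and> c = e)"
    using ptm_no_spaced_cube[of p] assms(1) w by (simp add: eval_nat_numeral)
  then show ?thesis
    unfolding w by (cases a; cases b; cases c; cases d; cases e) (simp_all add: has_square_Cons)
qed

text \<open>In an alternating word the length parity decides whether the two ends agree.\<close>

lemma has_square_if_hd_eq_last:
  assumes "w \<noteq> []" "even (length w)" "hd w = last w"
  shows "has_square w"
proof -
  have "hd w = last w \<longleftrightarrow> odd (length w)" if "\<not> has_square w" "w \<noteq> []" for w
    using that
  proof (induction w)
    case (Cons x w)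
    then show ?case
      by (cases "w = []"; cases x; cases "hd w"; cases "last w") (simp_all add: has_square_Cons)
  qed simp
  then show ?thesis
    using assms by blast
qed

text \<open>The two copies of \<open>A\<close> start at positions of different parity, so
  \<open>A\<close> must alternate and is therefore short.\<close>

lemma odd_square_root:
  assumes "occ p (A @ A)" "odd (length A)"
  shows "\<exists>x y. x \<noteq> y \<and> (A = [x] \<or> A = [x, y, x])"
proof -
  have "\<not> has_square A"
    using occ_parity[of A p "p + length A"] assms by auto
  then have "length A < 5"
    using has_square_if_long[of p A] assms by force
  then have "length A = 1 \<or> length A = 3"
    using assms(2) by presburger
  then show ?thesis
  proof
    assume "length A = 1"
    then obtain x where "A = [x]" by (auto simp: length_Suc_conv)
    then show ?thesis by (cases x) auto
  next
    assume "length A = 3"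
    then obtain x y z where A: "A = [x, y, z]" by (auto simp: numeral_eq_Suc length_Suc_conv)
    have "x \<noteq> y" "y \<noteq> z"
      using \<open>\<not> has_square A\<close> A by (auto simp: has_square_Cons)
    then show ?thesis
      using A letter_eqI by blast
  qed
qed

text \<open>An alternating \<open>A\<close> of even length has different ends, so all of
  \<open>A @ A\<close> alternates and has length below 5.\<close>

lemma even_square_root:
  assumes "occ p (A @ A)" "even (length A)" "A \<noteq> []" "\<not> has_square A"
  shows "\<exists>x. A = \<mu> [x]"
proof -
  have "\<not> has_square (A @ A)"
    using assms(2-4) has_square_if_hd_eq_last[of A] by (auto simp: has_square_append)
  then have "length (A @ A) < 5"
    using has_square_if_long[OF assms(1)] by force
  then have "length A = 2"
    using assms(2,3) by (cases A) (auto simp: numeral_eq_Suc less_Suc_eq)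
  then obtain x y where "A = [x, y]" by (auto simp: numeral_eq_Suc length_Suc_conv)
  then have "A = \<mu> [x]"
    using assms(4) by (cases x; cases y) (auto simp: has_square_Cons)
  then show ?thesis ..
qed

section \<open>The descent\<close>

text \<open>Here \<open>A\<close> and \<open>B\<close> stand for the images of the two letters. The
  condition is symmetric in them and survives removal of \<open>\<mu>\<close>, as the descent
  needs.\<close>

definition images_occur :: "letter list \<Rightarrow> letter list \<Rightarrow> bool" where
  "images_occur A B \<longleftrightarrow> A \<noteq> [] \<and> B \<noteq> [] \<and>
     (\<exists>p. occ p (A @ A @ B)) \<and> (\<exists>p. occ p (A @ B @ B)) \<and>
     (\<exists>p. occ p (B @ A @ A)) \<and> (\<exists>p. occ p (B @ B @ A)) \<and>
     ((\<exists>p. occ p (A @ B @ A)) \<or> (\<exists>p. occ p (B @ A @ B)))"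

lemma images_occur_commute: "images_occur A B \<longleftrightarrow> images_occur B A"
  unfolding images_occur_def by blast

lemma images_occur_parity_even:
  assumes AB: "images_occur A B" and odd_A: "odd (length A)" and even_B: "even (length B)"
  shows False
proof -
  obtain p q r where p: "occ p (A @ A @ B)" and q: "occ q (B @ A @ A)" and r: "occ r (A @ B @ B)"
    and ne: "A \<noteq> []" "B \<noteq> []"
    using AB unfolding images_occur_def by blast
  have A: "last A = hd A"
    using odd_square_root[of p A] p odd_A by auto
  have p_odd: "odd (p + length A + length A)"
    using occ_junction[of p A "A @ B"] p A ne odd_A by simp
  then have hd_B: "hd B \<noteq> hd A"
    using occ_junction[of p "A @ A" B] p A ne by (auto simp: add.assoc)
  have "odd (q + length B)"
    using occ_junction[of "q + length B" A A] q A ne odd_A by auto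
  then have last_B: "last B \<noteq> hd A"
    using occ_junction[of q B "A @ A"] q ne by auto
  \<comment> \<open>Both ends of \<open>B\<close> are the letter other than \<open>hd A\<close>. As
    \<open>B\<close> has even length, it contains a square and its positions have a fixed parity:
    odd by \<open>A @ A @ B\<close>, but even by the junction inside \<open>B @ B\<close>.\<close>
  have B: "last B = hd B"
    using letter_eqI[OF last_B hd_B] .
  then have "has_square B"
    using has_square_if_hd_eq_last ne even_B by simp
  then have "odd (r + length A)"
    using occ_parity[of B "p + length A + length A" "r + length A"] p r p_odd by simp
  moreover have "even (r + length A + length B)"
    using occ_junction[of "r + length A" B B] B r ne by simp
  ultimately show False
    using even_B by simp
qed

lemma images_occur_odd_odd:
  assumes AB: "images_occur A B" and odd_A: "odd (length A)" and odd_B: "odd (length B)"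
  shows "\<exists>x y. x \<noteq> y \<and> A = [x] \<and> B = [y]"
proof -
  obtain p q where p: "occ p (A @ A @ B)" and q: "occ q (A @ B @ B)" and ne: "A \<noteq> []" "B \<noteq> []"
    using AB unfolding images_occur_def by blast
  obtain m where m: "occ m (A @ B @ A) \<or> occ m (B @ A @ B)"
    using AB unfolding images_occur_def by blast
  obtain x y where A: "A = [x] \<or> A = [x, y, x]" and xy: "x \<noteq> y"
    using odd_square_root[of p A] p odd_A by auto
  obtain x' y' where B: "B = [x'] \<or> B = [x', y', x']" and xy': "x' \<noteq> y'"
    using odd_square_root[of "q + length A" B] q odd_B by auto
  have ends: "hd A = x" "last A = x" "hd B = x'"
    using A B by auto
  have "x \<noteq> x'"
  proof
    assume "x = x'"
    then have "even (p + length A)" "even (p + (length A + length A))"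
      using occ_junction[of p A "A @ B"] occ_junction[of p "A @ A" B] p ends ne by simp_all
    then show False
      using odd_A by simp
  qed
  then have y: "x' = y" "y' = x"
    using xy xy' letter_eqI by metis+
  have "A = [x] \<and> B = [y]"
  proof (rule ccontr)
    assume "\<not> (A = [x] \<and> B = [y])"
    \<comment> \<open>If either word had length 3, \<open>A @ B @ A\<close> and
      \<open>B @ A @ B\<close> would both alternate and have length at least 5.\<close>
    then have "ptm m = ptm (m + 2) \<and> ptm (m + 2) = ptm (m + 4)"
      using A B m unfolding y by (elim disjE) (simp_all add: eval_nat_numeral)
    then show False
      using ptm_no_spaced_cube by blast
  qed
  then show ?thesis
    using xy by blast
qed

lemma images_occur_aligned:
  assumes "A \<noteq> []" "B \<noteq> []" "even (length A)" "even (length B)"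
    and "even p1" "occ p1 (A @ A @ B)" "even p2" "occ p2 (A @ B @ B)"
    and "even p3" "occ p3 (B @ A @ A)" "even p4" "occ p4 (B @ B @ A)"
    and "even p5" "occ p5 (A @ B @ A) \<or> occ p5 (B @ A @ B)"
  shows "\<exists>A' B'. A = \<mu> A' \<and> B = \<mu> B' \<and> images_occur A' B'"
proof -
  obtain A' B' where AB: "A = \<mu> A'" "B = \<mu> B'"
    using occ_even_\<mu>[of "p1 div 2" A] occ_even_\<mu>[of "p3 div 2" B] assms by auto
  have *: "occ (p div 2) u" if "even p" "occ p (\<mu> u)" for p u
    using that occ_\<mu>[of "p div 2" u] by simp
  have "images_occur A' B'"
    unfolding images_occur_def
    using assms AB *[of p1 "A' @ A' @ B'"] *[of p2 "A' @ B' @ B'"] *[of p3 "B' @ A' @ A'"]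
      *[of p4 "B' @ B' @ A'"] *[of p5 "A' @ B' @ A'"] *[of p5 "B' @ A' @ B'"]
    by (simp only: \<mu>_simps \<mu>_eq_Nil_iff) blast
  then show ?thesis using AB by blast
qed

lemma hd_\<mu>: "hd (\<mu> w) = hd w" if "w \<noteq> []"
  using that by (cases w; cases "hd w") auto

lemma hd_\<mu>_pow: "hd ((\<mu> ^^ n) [x]) = x \<and> (\<mu> ^^ n) [x] \<noteq> []"
  by (induction n) (auto simp: hd_\<mu>)

text \<open>For odd \<open>p\<close>, positions \<open>p - 1\<close> and \<open>p\<close> form one
  block, so their letters differ; since the word does not start with \<open>c\<close>, the letter
  before it is \<open>c\<close>.\<close>

lemma occ_odd_rotate:
  assumes "odd p" "occ p (w @ [c])" "hd (w @ [c]) \<noteq> c"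
  shows "even (p - 1) \<and> occ (p - 1) (c # w)"
proof -
  obtain k where k: "p = Suc k" "even k"
    using assms(1) by (cases p) auto
  have "ptm p \<noteq> c"
    using assms occ_hd[of p "w @ [c]"] by simp
  moreover have "ptm k \<noteq> ptm p"
    using k ptm_square[of k] by auto
  ultimately show ?thesis
    using assms(2) k letter_eqI[of "ptm k" c "ptm p"] by auto
qed

theorem images_occur_cases:
  assumes "images_occur A B"
  shows "\<exists>n x y. x \<noteq> y \<and> A = (\<mu> ^^ n) [x] \<and> B = (\<mu> ^^ n) [y]"
  using assms
proof (induction "length A + length B" arbitrary: A B rule: less_induct)
  case less
  \<comment> \<open>Stated for any pair with the lengths of \<open>A\<close> and \<open>B\<close>,
    since it is also applied to the rotated pair below.\<close>
  have descent: "\<exists>n x y. x \<noteq> y \<and> A1 = (\<mu> ^^ n) [x] \<and> B1 = (\<mu> ^^ n) [y]"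
    if AB: "A1 = \<mu> A2" "B1 = \<mu> B2" "images_occur A2 B2"
      and len: "length A1 = length A" "length B1 = length B"
    for A1 B1 A2 B2
  proof -
    have "length A2 + length B2 < length A + length B"
      using AB unfolding len[symmetric] images_occur_def by simp
    then obtain n x y where "x \<noteq> y" "A2 = (\<mu> ^^ n) [x]" "B2 = (\<mu> ^^ n) [y]"
      using less.hyps AB(3) by blast
    then show ?thesis
      using AB by (intro exI[of _ "Suc n"] exI[of _ x] exI[of _ y]) simp
  qed
  have ne: "A \<noteq> []" "B \<noteq> []"
    using less.prems unfolding images_occur_def by auto
  obtain p1 p2 p3 p4 p5 where o: "occ p1 (A @ A @ B)" "occ p2 (A @ B @ B)"
    "occ p3 (B @ A @ A)" "occ p4 (B @ B @ A)" "occ p5 (A @ B @ A) \<or> occ p5 (B @ A @ B)"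
    using less.prems unfolding images_occur_def by blast
  consider "odd (length A) \<or> odd (length B)"
    | "even (length A)" "even (length B)" "\<not> has_square A" "\<not> has_square B"
    | "even (length A)" "even (length B)" "has_square A \<or> has_square B"
    by blast
  then show ?case
  proof cases
    case 1
    then have "odd (length A)" "odd (length B)"
      using images_occur_parity_even less.prems images_occur_commute by blast+
    then obtain x y where "x \<noteq> y" "A = [x]" "B = [y]"
      using images_occur_odd_odd less.prems by blast
    then show ?thesis
      by (intro exI[of _ 0] exI[of _ x] exI[of _ y]) simp
  next
    case 2
    obtain x where x: "A = \<mu> [x]"
      using even_square_root[of p1 A] 2 o ne by auto
    obtain y where y: "B = \<mu> [y]"
      using even_square_root[of p4 B] 2 o ne by auto
    have "x \<noteq> y"
    proof
      assume "x = y"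
      \<comment> \<open>With equal words, \<open>A @ A @ B\<close> would be the cube of a two-letter
        block, hence alternating of length 6.\<close>
      then show False
        using o(1) x y ptm_no_spaced_cube[of p1] by (cases x) (auto simp: eval_nat_numeral)
    qed
    then show ?thesis
      using x y by (intro exI[of _ "Suc 0"] exI[of _ x] exI[of _ y]) simp
  next
    case 3
    \<comment> \<open>All copies of the word with a square start at positions of one parity, and the
      even lengths carry this parity to the starts of all five occurrences.\<close>
    have par: "even p2 = even p1 \<and> even p3 = even p1 \<and> even p4 = even p1 \<and> even p5 = even p1"
      using 3(3)
    proof
      assume "has_square A"
      note * = occ_parity[OF this]
      show ?thesis
        using o *[of p1 p2] *[of p1 "p3 + length B"] *[of p1 "p4 + length B + length B"]
          *[of p1 p5] *[of p1 "p5 + length B"] 3(1,2) by auto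
    next
      assume "has_square B"
      note * = occ_parity[OF this]
      show ?thesis
        using o *[of "p2 + length A" "p1 + length A + length A"]
          *[of p3 "p1 + length A + length A"] *[of p4 "p1 + length A + length A"]
          *[of p5 "p1 + length A + length A"] *[of "p5 + length A" "p1 + length A + length A"]
          3(1,2) by auto
    qed
    show ?thesis
    proof (cases "even p1")
      case True
      then obtain A' B' where "A = \<mu> A'" "B = \<mu> B'" "images_occur A' B'"
        using images_occur_aligned[of A B p1 p2 p3 p4 p5] ne 3 o par by metis
      then show ?thesis
        using descent by blast
    next
      case odd: False
      \<comment> \<open>All starts are odd and all lengths even, so no junction falls on an even
        position and no square of a letter can straddle one.\<close>
      have j: "last A \<noteq> hd A" "last A \<noteq> hd B" "last B \<noteq> hd A"
        using occ_junction[of p1 A "A @ B"] occ_junction[of p2 A "B @ B"]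
          occ_junction[of p3 B "A @ A"] o odd par 3 ne by auto
      define c where "c = last A"
      have "last B = c"
        unfolding c_def using j letter_eqI by metis
      then obtain U V where UV: "A = U @ [c]" "B = V @ [c]"
        unfolding c_def using ne by (metis append_butlast_last_id)
      have hd: "hd (A @ w) \<noteq> c" "hd (B @ w) \<noteq> c" for w
        using j ne unfolding c_def by auto
      let ?A = "c # U" and ?B = "c # V"
      have "\<exists>A' B'. ?A = \<mu> A' \<and> ?B = \<mu> B' \<and> images_occur A' B'"
      proof (rule images_occur_aligned)
        show "even (p1 - 1)" "occ (p1 - 1) (?A @ ?A @ ?B)"
          using occ_odd_rotate[of p1 "A @ A @ V" c] odd o(1) hd(1)[of "A @ V @ [c]"] UV by auto
        show "even (p2 - 1)" "occ (p2 - 1) (?A @ ?B @ ?B)"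
          using occ_odd_rotate[of p2 "A @ B @ V" c] odd par o(2) hd(1)[of "B @ V @ [c]"] UV by auto
        show "even (p3 - 1)" "occ (p3 - 1) (?B @ ?A @ ?A)"
          using occ_odd_rotate[of p3 "B @ A @ U" c] odd par o(3) hd(2)[of "A @ U @ [c]"] UV by auto
        show "even (p4 - 1)" "occ (p4 - 1) (?B @ ?B @ ?A)"
          using occ_odd_rotate[of p4 "B @ B @ U" c] odd par o(4) hd(2)[of "B @ U @ [c]"] UV by auto
        show "even (p5 - 1)"
          using odd par by auto
        show "occ (p5 - 1) (?A @ ?B @ ?A) \<or> occ (p5 - 1) (?B @ ?A @ ?B)"
          using occ_odd_rotate[of p5 "A @ B @ U" c] occ_odd_rotate[of p5 "B @ A @ V" c] odd par o(5)
            hd(1)[of "B @ U @ [c]"] hd(2)[of "A @ V @ [c]"] UV by auto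
      qed (use 3 UV in auto)
      then obtain A' B' where "?A = \<mu> A'" "?B = \<mu> B'" "images_occur A' B'"
        by blast
      moreover have "length ?A = length A" "length ?B = length B"
        using UV by simp_all
      ultimately obtain n x y where "x \<noteq> y" "?A = (\<mu> ^^ n) [x]" "?B = (\<mu> ^^ n) [y]"
        using descent by blast
      \<comment> \<open>A contradiction: both rotated words begin with \<open>c\<close>, whereas
        their first letters are the distinct \<open>x\<close> and \<open>y\<close>.\<close>
      then show ?thesis
        using hd_\<mu>_pow by (metis list.sel(1))
    qed
  qed
qed

section \<open>Endomorphisms\<close>

lemma endomorphism_sublist:
  assumes "endomorphism \<phi>" "sublist u w" "u \<noteq> []"
  shows "sublist (\<phi> u) (\<phi> w)"
proof -
  have app: "\<phi> (v @ v') = \<phi> v @ \<phi> v'" if "v \<noteq> []" "v' \<noteq> []" for v v'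
    using assms(1) that by (simp add: endomorphism_def words_def)
  obtain x y where w: "w = x @ u @ y"
    using assms(2) by (auto simp: sublist_def)
  show ?thesis
    unfolding w using assms(3) app
    \<comment> \<open>Empty contexts are split off because \<phi> is multiplicative on nonempty
      words only.\<close>
    by (cases "x = []"; cases "y = []") auto
qed

lemma endomorphism_eqI:
  assumes "endomorphism \<phi>" "endomorphism \<psi>" "\<phi> [La] = \<psi> [La]" "\<phi> [Lb] = \<psi> [Lb]" "u \<in> words"
  shows "\<phi> u = \<psi> u"
proof -
  have "u \<noteq> []" using assms(5) by (simp add: words_def)
  then show ?thesis
  proof (induction u rule: list_nonempty_induct)
    case (single x)
    then show ?case using assms(3,4) by (cases x) auto
  next
    case (cons x u)
    have "\<phi> ([x] @ u) = \<phi> [x] @ \<phi> u" "\<psi> ([x] @ u) = \<psi> [x] @ \<psi> u"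
      using assms(1,2) cons(1) by (simp_all add: endomorphism_def words_def del: append_Cons)
    then show ?case using assms(3,4) cons(2) by (cases x) auto
  qed
qed

lemma endomorphism_\<mu>_pow: "endomorphism (\<mu> ^^ n)"
proof -
  have "(\<mu> ^^ n) u = [] \<longleftrightarrow> u = []" for u
    using length_\<mu>_pow[of n u] by (metis length_0_conv mult_eq_0_iff power_eq_0_iff zero_neq_numeral)
  then show ?thesis
    by (simp add: endomorphism_def words_def \<mu>_pow_append)
qed

lemma endomorphism_\<xi>_\<mu>_pow: "endomorphism (\<xi> \<circ> \<mu> ^^ n)"
  using endomorphism_\<mu>_pow[of n] by (simp add: endomorphism_def words_def)

lemma \<xi>_\<mu>: "\<xi> (\<mu> w) = \<mu> (\<xi> w)"
proof (induction w)
  case (Cons x w)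
  then show ?case by (cases x) auto
qed simp

lemma \<xi>_\<mu>_pow: "\<xi> ((\<mu> ^^ n) w) = (\<mu> ^^ n) (\<xi> w)"
  by (induction n) (simp_all add: \<xi>_\<mu>)

theorem theorem4p2:
  fixes w :: "letter list"
  assumes "w \<in> words"
    and "segment ptm w"
    and "sublist [La, Lb, La] w \<or> sublist [Lb, La, Lb] w"
    and "sublist [La, La, Lb] w"
    and "sublist [La, Lb, Lb] w"
    and "sublist [Lb, La, La] w"
    and "sublist [Lb, Lb, La] w"
  shows "typical w"
proof -
  have "\<exists>n. (\<forall>u\<in>words. \<phi> u = (\<mu> ^^ n) u) \<or> (\<forall>u\<in>words. \<phi> u = (\<xi> \<circ> \<mu> ^^ n) u)"
    if \<phi>: "endomorphism \<phi>" and seg: "segment ptm (\<phi> w)" for \<phi>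
  proof -
    have app: "\<phi> (x # y # v) = \<phi> [x] @ \<phi> (y # v)" for x y v
    proof -
      have "\<phi> ([x] @ y # v) = \<phi> [x] @ \<phi> (y # v)"
        using \<phi> unfolding endomorphism_def words_def by blast
      then show ?thesis by simp
    qed
    have occ3: "\<exists>p. occ p (\<phi> [x] @ \<phi> [y] @ \<phi> [z])" if "sublist [x, y, z] w" for x y z
      using occ_if_sublist_segment[OF seg endomorphism_sublist[OF \<phi> that]] by (simp add: app)
    have "\<phi> [x] \<noteq> []" for x
      using \<phi> by (simp add: endomorphism_def words_def)
    then have "images_occur (\<phi> [La]) (\<phi> [Lb])"
      unfolding images_occur_def using assms(3-7) occ3 by blast
    then obtain n x y where xy: "x \<noteq> y" "\<phi> [La] = (\<mu> ^^ n) [x]" "\<phi> [Lb] = (\<mu> ^^ n) [y]"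
      using images_occur_cases by blast
    show ?thesis
    proof (cases x)
      case La
      then have "y = Lb" using xy(1) by (cases y) auto
      then show ?thesis
        using endomorphism_eqI[OF \<phi> endomorphism_\<mu>_pow] xy La by blast
    next
      case Lb
      then have "y = La" using xy(1) by (cases y) auto
      \<comment> \<open>The exchanged letters are \<xi> applied before \<open>\<mu> ^^ n\<close>; as
        \<xi> commutes with \<open>\<mu>\<close>, it may be applied last.\<close>
      then have "\<phi> [La] = (\<xi> \<circ> \<mu> ^^ n) [La]" "\<phi> [Lb] = (\<xi> \<circ> \<mu> ^^ n) [Lb]"
        using xy Lb by (simp_all add: \<xi>_\<mu>_pow)
      then show ?thesis
        using endomorphism_eqI[OF \<phi> endomorphism_\<xi>_\<mu>_pow] by blast
    qed
  qed
  then show ?thesis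
    unfolding typical_def atypical_def using assms(2) by blast
qed

end
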